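(* Let $X,Y$ be normed spaces, $Y_+\subset Y$ a non-trivial closed convex cone inducing a partial order on $Y$ ($y_1\le y_2$ iff $y_2-y_1\in Y_+$), $\bar F:X\times X\rightrightarrows Y$ a set-valued bifunction such that $\bar F(x,x)$ is a singleton for every $x\in X$, and $\Sigma\subset X$ a nonempty set such that $\bar F(x,x)=\{0_Y\}$ for all $x\in\Sigma$. Let $x_0\in\Sigma$ be a solution of the equilibrium problem $(E)$, i.e. $\bar F(x_0,x)\cap(-Y_+)\subset Y_+$ for all $x\in\Sigma$. Define $F,G:X\rightrightarrows Y$ by $F(x):=\bar F(x_0,x)$ and $G(x):=\bar F(x,x)$. Let $U\subset Y$ be an open neighborhood of $0_Y$, let $V:U\rightrightarrows Y$, $V(z):=\bigcup_{x\in X,\ z\in G(x)}F(x)$, and assume that $V(z)\neq\varnothing$ for every $z\in U$, that $V(0_Y)\cap(-Y_+)\subset Y_+$, and that there exists at least one process $\Delta'\in P(Y,Y)$ satisfying (a) $\operatorname{core}(\operatorname{Gph}(\Delta'))\ne\varnothing$; (b) $Y_+\subseteq\Delta'(0_Y)$ and $(-Y_+)\cap\Delta'(0_Y)\subseteq Y_+$; (c) $\operatorname{Gph}(-\Delta')\cap\operatorname{Gph}(V)\subseteq\{0_{Y\times Y}\}$. Then there exists a convex process $\Delta\in P(Y,Y)$ such that $0_Y$ is a minimal point of the program "Minimize $F(x)+\Delta(G(x))$ subject to $x\in X$", that is, with $A:=\bigcup_{x\in X}(F(x)+\Delta(G(x)))$, one has $0_Y\in A$ and $A\cap(-Y_+)\subset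 Y_+$. Moreover, $$\Delta(G(x_0))\cap(-Y_+)\subseteq Y_+.$$
   Context: All normed spaces are real. A cone is a nonempty set $K$ with $\alpha K\subset K$ for all $\alpha\ge0$; it is non-trivial if $\{0_Y\}\subsetneq K\subsetneq Y$. For a set-valued map $\Delta$, $\operatorname{Gph}(\Delta)=\{(z,y):y\in\Delta(z)\}$, $\Delta(A)=\bigcup_{a\in A}\Delta(a)$, $(-\Delta)(z):=-\Delta(z)$. $P(Y,Y)$ is the set of all $\Delta:Y\rightrightarrows Y$ whose graph is a closed convex cone and with $\Delta(z)\ne\varnothing$ for all $z\in Y$. For a subset $A$ of a vector space $E$, $\operatorname{core}(A)=\{a\in A:\forall x\in E\ \exists\delta>0,\ a+[0,\delta]x\subset A\}$. Sums of sets are Minkowski sums, with $A+\varnothing=\varnothing$.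
   Formalization: V is defined by its formula for all z in Y rather than only z in U, so condition (c) is required over all of Y; with V restricted to U the claim fails when some G(x) lies outside U (e.g. F(2) = R, G(2) = {2}, U = (-1,1)). *)

theory Defs
  imports "HOL-Analysis.Analysis"
begin

text \<open>
  A set-valued map from \<open>Z\<close> to \<open>Y\<close> is a function of type \<open>'z \<Rightarrow> 'y set\<close>. Minkowski sums are the
  \<open>+\<close> on sets of \<^theory>\<open>HOL-Library.Set_Algebras\<close>. The unary minus on sets is the
  complement, so the set of the negatives of the members of \<open>A\<close> is written \<open>uminus ` A\<close>.
\<close>

definition Gph :: "('z \<Rightarrow> 'y set) \<Rightarrow> ('z \<times> 'y) set" where
  "Gph D = {(z, y). y \<in> D z}"

definition image_map :: "('z \<Rightarrow> 'y set) \<Rightarrow> 'z set \<Rightarrow> 'y set" where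
  "image_map D A = (\<Union>a\<in>A. D a)"

definition neg_map :: "('z \<Rightarrow> 'y::uminus set) \<Rightarrow> 'z \<Rightarrow> 'y set" where
  "neg_map D = (\<lambda>z. uminus ` D z)"

text \<open>The library predicate \<^const>\<open>cone\<close> also holds of the empty set.\<close>

definition closed_convex_cone :: "'a::real_normed_vector set \<Rightarrow> bool" where
  "closed_convex_cone K \<longleftrightarrow> K \<noteq> {} \<and> cone K \<and> convex K \<and> closed K"

definition nontrivial_cone :: "'a::real_normed_vector set \<Rightarrow> bool" where
  "nontrivial_cone K \<longleftrightarrow> {0} \<subset> K \<and> K \<subset> UNIV"

definition processes :: "('z::real_normed_vector \<Rightarrow> 'y::real_normed_vector set) set" where
  "processes = {D. closed_convex_cone (Gph D) \<and> (\<forall>z. D z \<noteq> {})}"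

definition core :: "'a::real_vector set \<Rightarrow> 'a set" where
  "core A = {a \<in> A. \<forall>x. \<exists>\<delta>>0. (\<lambda>t. a + t *\<^sub>R x) ` {0..\<delta>} \<subseteq> A}"

definition solves_equilibrium ::
  "('x \<Rightarrow> 'x \<Rightarrow> 'y::uminus set) \<Rightarrow> 'y set \<Rightarrow> 'x set \<Rightarrow> 'x \<Rightarrow> bool" where
  "solves_equilibrium Fbar Yp \<Sigma> x\<^sub>0 \<longleftrightarrow>
     x\<^sub>0 \<in> \<Sigma> \<and> (\<forall>x\<in>\<Sigma>. Fbar x\<^sub>0 x \<inter> uminus ` Yp \<subseteq> Yp)"

text \<open>
  The value map of the perturbed programs is given by its formula at every \<open>z\<close>, not only at the
  \<open>z\<close> in a neighbourhood \<open>U\<close> of \<open>0\<close>, and its graph is the graph over the whole space. If no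
  \<open>G x\<close> leaves \<open>U\<close>, this is the same graph as over \<open>U\<close>; otherwise a condition on the graph
  over \<open>U\<close> would say nothing about those \<open>x\<close> for which \<open>G x\<close> lies outside \<open>U\<close>, although they
  take part in the program.
\<close>

definition value_map :: "('x \<Rightarrow> 'y set) \<Rightarrow> ('x \<Rightarrow> 'z set) \<Rightarrow> 'z \<Rightarrow> 'y set" where
  "value_map F G z = (\<Union>x\<in>{x. z \<in> G x}. F x)"

text \<open>
  \<open>0\<close> is a minimal point of \<open>A\<close> for the order \<open>y\<^sub>1 \<le> y\<^sub>2 \<longleftrightarrow> y\<^sub>2 - y\<^sub>1 \<in> Yp\<close>; as \<open>Yp\<close> need not be
  pointed, minimality only requires \<open>0 \<le> y\<close> for every \<open>y \<in> A\<close> with \<open>y \<le> 0\<close>.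
\<close>

definition zero_minimal :: "'y::{uminus,zero} set \<Rightarrow> 'y set \<Rightarrow> bool" where
  "zero_minimal Yp A \<longleftrightarrow> 0 \<in> A \<and> A \<inter> uminus ` Yp \<subseteq> Yp"

definition program_values ::
  "('x \<Rightarrow> 'y::plus set) \<Rightarrow> ('x \<Rightarrow> 'z set) \<Rightarrow> ('z \<Rightarrow> 'y set) \<Rightarrow> 'y set" where
  "program_values F G D = (\<Union>x. F x + image_map D (G x))"

end

theory Submission
  imports Defs
begin

text \<open>
  The given process \<open>\<Delta>'\<close> itself works: if \<open>f + d = -p\<close> with \<open>f \<in> F x\<close>, \<open>d \<in> \<Delta>' (G x)\<close> and
  \<open>p \<in> Yp \<subseteq> \<Delta>' 0\<close>, then \<open>-f = d + p\<close> lies in \<open>\<Delta>' (G x)\<close> by superadditivity, so the separation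
  of the graphs forces \<open>G x = {0}\<close> and \<open>f = 0\<close>, whence \<open>-p = d \<in> \<Delta>' 0\<close> belongs to \<open>Yp\<close>.
\<close>

text \<open>Superadditivity: the graph is a convex cone, hence closed under addition of
  pairs.\<close>

lemma processes_add:
  assumes "D \<in> processes" "a \<in> D y" "b \<in> D z"
  shows "a + b \<in> D (y + z)"
proof -
  have "cone (Gph D)" "convex (Gph D)" "(y, a) \<in> Gph D" "(z, b) \<in> Gph D"
    using assms by (auto simp: processes_def closed_convex_cone_def Gph_def)
  then have "(y, a) + (z, b) \<in> Gph D"
    using convex_cone[of "Gph D"] by blast
  then show ?thesis by (simp add: Gph_def)
qed

lemma processes_zero:
  assumes "D \<in> processes"
  shows "0 \<in> D 0"
proof -
  have "0 \<in> Gph D"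
    using assms cone_contains_0[of "Gph D"] by (simp add: processes_def closed_convex_cone_def)
  then show ?thesis by (simp add: Gph_def zero_prod_def)
qed

lemma program_values_Int_neg_subset:
  assumes D: "D \<in> processes"
    and Yp: "Yp \<subseteq> D 0" "uminus ` Yp \<inter> D 0 \<subseteq> Yp"
    and sep: "Gph (neg_map D) \<inter> Gph (value_map F G) \<subseteq> {0}"
  shows "program_values F G D \<inter> uminus ` Yp \<subseteq> Yp"
proof
  fix y assume "y \<in> program_values F G D \<inter> uminus ` Yp"
  then obtain x f d z p where *: "f \<in> F x" "z \<in> G x" "d \<in> D z" "p \<in> Yp"
    and y: "y = f + d" "y = - p"
    by (auto simp: program_values_def image_map_def elim!: set_plus_elim)
  \<comment> \<open>Since \<open>p\<close> is a value at \<open>0\<close>, adding it to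
    \<open>d\<close> leaves the base point \<open>z\<close> unchanged.\<close>
  have "d + p \<in> D z"
    using processes_add[OF D, of d z p 0] * Yp by auto
  moreover have f: "f = - (d + p)"
    using y by (simp add: eq_neg_iff_add_eq_0 add.assoc [symmetric])
  ultimately have "(z, f) \<in> Gph (neg_map D)"
    unfolding Gph_def neg_map_def by blast
  moreover have "(z, f) \<in> Gph (value_map F G)"
    using * by (auto simp: Gph_def value_map_def)
  ultimately have "z = 0" "f = 0"
    using sep by (auto simp: zero_prod_def)
  \<comment> \<open>With \<open>f = 0\<close> the point \<open>y\<close> equals \<open>d\<close>, a
    value of \<open>D\<close> at \<open>z = 0\<close>, and also \<open>- p\<close>; so the second
    inclusion in \<open>Yp\<close> applies.\<close>
  then show "y \<in> Yp"
    using Yp(2) * y by auto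
qed

theorem theorem5p2:
  fixes Yp :: "'y::real_normed_vector set"
    and Fbar :: "'x::real_normed_vector \<Rightarrow> 'x \<Rightarrow> 'y set"
    and \<Sigma> :: "'x set"
    and x\<^sub>0 :: 'x
    and F G :: "'x \<Rightarrow> 'y set"
    and U :: "'y set"
    and V :: "'y \<Rightarrow> 'y set"
  assumes "closed_convex_cone Yp" and "nontrivial_cone Yp"
    and "\<forall>x. is_singleton (Fbar x x)"
    and "\<Sigma> \<noteq> {}"
    and "\<forall>x\<in>\<Sigma>. Fbar x x = {0}"
    and "solves_equilibrium Fbar Yp \<Sigma> x\<^sub>0"
    and "F = (\<lambda>x. Fbar x\<^sub>0 x)"
    and "G = (\<lambda>x. Fbar x x)"
    and "open U" and "0 \<in> U"
    and "V = value_map F G"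
    and "\<forall>z\<in>U. V z \<noteq> {}"
    and "V 0 \<inter> uminus ` Yp \<subseteq> Yp"
    and "\<exists>\<Delta>'\<in>processes.
           core (Gph \<Delta>') \<noteq> {} \<and>
           Yp \<subseteq> \<Delta>' 0 \<and> uminus ` Yp \<inter> \<Delta>' 0 \<subseteq> Yp \<and>
           Gph (neg_map \<Delta>') \<inter> Gph V \<subseteq> {0}"
  shows "\<exists>\<Delta>\<in>processes.
           zero_minimal Yp (program_values F G \<Delta>) \<and>
           image_map \<Delta> (G x\<^sub>0) \<inter> uminus ` Yp \<subseteq> Yp"
proof -
  obtain D where D: "D \<in> processes"
    and Yp: "Yp \<subseteq> D 0" "uminus ` Yp \<inter> D 0 \<subseteq> Yp"
    and sep: "Gph (neg_map D) \<inter> Gph (value_map F G) \<subseteq> {0}"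
    using assms(14) unfolding assms(11) by (elim bexE conjE) (rule that)
  have "x\<^sub>0 \<in> \<Sigma>"
    using assms by (simp add: solves_equilibrium_def)
  \<comment> \<open>Both sets are the diagonal value
    \<open>Fbar x\<^sub>0 x\<^sub>0\<close>.\<close>
  then have "F x\<^sub>0 = {0}" and G: "G x\<^sub>0 = {0}"
    using assms by auto
  \<comment> \<open>The value \<open>0\<close> is attained at \<open>x\<^sub>0\<close>, because
    \<open>0 \<in> D 0\<close>.\<close>
  then have "0 + 0 \<in> F x\<^sub>0 + image_map D (G x\<^sub>0)"
    using processes_zero[OF D] by (intro set_plus_intro) (auto simp: image_map_def)
  then have "0 \<in> program_values F G D"
    unfolding program_values_def by auto
  then have "zero_minimal Yp (program_values F G D)"
    using program_values_Int_neg_subset[OF D Yp sep] by (simp add: zero_minimal_def)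
  \<comment> \<open>As \<open>G x\<^sub>0 = {0}\<close>, the image is just
    \<open>D 0\<close>.\<close>
  moreover have "image_map D (G x\<^sub>0) \<inter> uminus ` Yp \<subseteq> Yp"
    using Yp(2) by (auto simp: image_map_def G)
  ultimately show ?thesis
    using D by blast
qed

end
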